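(* Let $\kappa>0$, $\nu\in(-1,1/2]$. For all $\gamma>0$ and $\beta\ne0$ satisfying $\beta\le3\frac{1-\nu}{1+\nu}\gamma$, the polytropic elastic constitutive function $(\widehat p_{\mathrm{rad}},\widehat p_{\mathrm{tan}})$ with parameters $\kappa,\nu,\gamma,\beta$ satisfies the weak Baker-Ericksen inequality and the weak non-negative stored energy condition. It satisfies the strong Baker-Ericksen inequality and the strong non-negative stored energy condition as well if and only if, in addition, $$\beta\ge\min\left(\gamma,\;3\frac{1-\nu}{1+\nu}\gamma-\frac{2(1-2\nu)}{1+\nu}\right)=\begin{cases}\gamma & \text{if }\gamma\ge1,\\[2pt] 3\frac{1-\nu}{1+\nu}\gamma-\frac{2(1-2\nu)}{1+\nu} & \text{if }0<\gamma<1.\end{cases}$$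
   Context: Polytropic elastic constitutive function. For $\kappa>0$, $\nu\in(-1,1/2]$, $\gamma>0$, $\beta\ne0$ with $\beta\le 3\frac{1-\nu}{1+\nu}\gamma$, put $y_{\mathrm b}=\left[1-\frac{\beta}{3\gamma}\frac{1+\nu}{1-\nu}\right]^{1/\beta}$ and, for $(\delta,\eta)\in(0,\infty)^2$, $$\kappa^{-1}\widehat p_{\mathrm{rad}}(\delta,\eta)=\frac{3(1-\nu)}{\beta(1+\nu)}\big((\delta/\eta)^\beta-y_{\mathrm b}^\beta\big)\eta^\gamma-\frac1\gamma,\qquad \kappa^{-1}\widehat p_{\mathrm{tan}}(\delta,\eta)=\kappa^{-1}\widehat p_{\mathrm{rad}}(\delta,\eta)+3(1-\delta/\eta)Q(\delta/\eta)\eta^\gamma,$$ where $$Q(y)=\begin{cases}\dfrac{3(\beta-\gamma)(1-\nu)}{2\beta(\beta-1)(1+\nu)}\dfrac{1-y^\beta}{1-y}+\dfrac{3(\gamma-1)(1-\nu)}{2(\beta-1)(1+\nu)}-\dfrac12 & \beta\ne1,\\[8pt] \dfrac{3(\gamma-1)(1-\nu)}{2(1+\nu)}\dfrac{y\log y}{1-y}+\dfrac{3\gamma(1-\nu)}{2(1+\nu)}-\dfrac12 & \beta=1,\end{cases}$$ extended continuously to $y=1$. This constitutive function is hyperelastic: there is a unique function $\widehat w:(0,\infty)^2\to\mathbb{R}$ (the stored energy function) with $\widehat w(1,1)=0$, $\widehat p_{\mathrm{rad}}=\delta^2\partial_\delta\widehat w$ and $\widehat p_{\mathrm{tan}}=\widehat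 p_{\mathrm{rad}}+\frac32\delta\eta\,\partial_\eta\widehat w$. Explicitly, with $y=\delta/\eta$, $$\kappa^{-1}\widehat w(\delta,\eta)=\begin{cases}\eta^{\gamma-1}\left(3S(y)-\frac1\gamma y^{-1}+\frac1{\gamma-1}\right)+\frac{\delta^{-1}}{\gamma}-\frac1{\gamma-1} & \gamma\ne1,\\ 3S(y)-y^{-1}-\log y+\log\delta+\delta^{-1} & \gamma=1,\end{cases}$$ where $S(y)=\frac{1-\nu}{1+\nu}\left(\frac{y^{\beta-1}}{\beta(\beta-1)}+\frac{y^{-1}}{\beta}-\frac1{\beta-1}\right)$ if $\beta\ne1$ and $S(y)=\frac{1-\nu}{1+\nu}(\log y+y^{-1}-1)$ if $\beta=1$. Baker-Ericksen inequality: the inequality $\dfrac{\widehat p_{\mathrm{tan}}(\delta,\eta)-\widehat p_{\mathrm{rad}}(\delta,\eta)}{\eta-\delta}\ge0$, understood as a limit when $\eta=\delta$. The strong version requires it for all $(\delta,\eta)\in(0,\infty)^2$; the weak version requires it for all $\eta\ge\delta>0$. Non-negative stored energy condition: $\widehat w(\delta,\eta)\ge0$ for all $(\delta,\eta)\in(0,\infty)^2$ (strong), respectively for all $\eta\ge\delta>0$ (weak). *)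

theory Defs
  imports "HOL-Analysis.Analysis"
begin

(* A constitutive function is a pair of curried functions
   p_rad, p_tan :: real => real => real in the arguments delta and eta.
   Only their values at positive arguments matter. *)

section \<open>The polytropic elastic constitutive function\<close>

definition y_b :: "real \<Rightarrow> real \<Rightarrow> real \<Rightarrow> real" where
  "y_b \<nu> \<gamma> \<beta> = (1 - \<beta> / (3 * \<gamma>) * ((1 + \<nu>) / (1 - \<nu>))) powr (1 / \<beta>)"

definition p_rad :: "real \<Rightarrow> real \<Rightarrow> real \<Rightarrow> real \<Rightarrow> real \<Rightarrow> real \<Rightarrow> real" where
  "p_rad \<kappa> \<nu> \<gamma> \<beta> \<delta> \<eta> =
     \<kappa> * (3 * (1 - \<nu>) / (\<beta> * (1 + \<nu>)) * ((\<delta> / \<eta>) powr \<beta> - y_b \<nu> \<gamma> \<beta> powr \<beta>) * \<eta> powr \<gamma>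
          - 1 / \<gamma>)"

text \<open>The formula for \<open>Q\<close> away from \<open>y = 1\<close>, where it has a removable singularity.\<close>

definition Q_formula :: "real \<Rightarrow> real \<Rightarrow> real \<Rightarrow> real \<Rightarrow> real" where
  "Q_formula \<nu> \<gamma> \<beta> y =
     (if \<beta> \<noteq> 1 then
        3 * (\<beta> - \<gamma>) * (1 - \<nu>) / (2 * \<beta> * (\<beta> - 1) * (1 + \<nu>)) * ((1 - y powr \<beta>) / (1 - y))
        + 3 * (\<gamma> - 1) * (1 - \<nu>) / (2 * (\<beta> - 1) * (1 + \<nu>)) - 1 / 2
      else
        3 * (\<gamma> - 1) * (1 - \<nu>) / (2 * (1 + \<nu>)) * (y * ln y / (1 - y))
        + 3 * \<gamma> * (1 - \<nu>) / (2 * (1 + \<nu>)) - 1 / 2)"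

definition Q :: "real \<Rightarrow> real \<Rightarrow> real \<Rightarrow> real \<Rightarrow> real" where
  "Q \<nu> \<gamma> \<beta> y = (if y = 1 then Lim (at 1) (Q_formula \<nu> \<gamma> \<beta>) else Q_formula \<nu> \<gamma> \<beta> y)"

definition p_tan :: "real \<Rightarrow> real \<Rightarrow> real \<Rightarrow> real \<Rightarrow> real \<Rightarrow> real \<Rightarrow> real" where
  "p_tan \<kappa> \<nu> \<gamma> \<beta> \<delta> \<eta> =
     p_rad \<kappa> \<nu> \<gamma> \<beta> \<delta> \<eta> + \<kappa> * (3 * (1 - \<delta> / \<eta>) * Q \<nu> \<gamma> \<beta> (\<delta> / \<eta>) * \<eta> powr \<gamma>)"

section \<open>The Baker-Ericksen inequality\<close>

text \<open>On the diagonal the quotient is understood as the (full two-variable) limit along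
  off-diagonal points, which is required to exist.\<close>

definition baker_ericksen_at ::
    "(real \<Rightarrow> real \<Rightarrow> real) \<Rightarrow> (real \<Rightarrow> real \<Rightarrow> real) \<Rightarrow> real \<Rightarrow> real \<Rightarrow> bool" where
  "baker_ericksen_at pr pt \<delta> \<eta> \<longleftrightarrow>
     (if \<eta> \<noteq> \<delta> then (pt \<delta> \<eta> - pr \<delta> \<eta>) / (\<eta> - \<delta>) \<ge> 0
      else \<exists>L\<ge>0. ((\<lambda>(d, e). (pt d e - pr d e) / (e - d)) \<longlongrightarrow> L)
                   (at (\<delta>, \<eta>) within {(d, e). d > 0 \<and> e > 0 \<and> d \<noteq> e}))"

definition strong_baker_ericksen ::
    "(real \<Rightarrow> real \<Rightarrow> real) \<Rightarrow> (real \<Rightarrow> real \<Rightarrow> real) \<Rightarrow> bool" where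
  "strong_baker_ericksen pr pt \<longleftrightarrow> (\<forall>\<delta>>0. \<forall>\<eta>>0. baker_ericksen_at pr pt \<delta> \<eta>)"

definition weak_baker_ericksen ::
    "(real \<Rightarrow> real \<Rightarrow> real) \<Rightarrow> (real \<Rightarrow> real \<Rightarrow> real) \<Rightarrow> bool" where
  "weak_baker_ericksen pr pt \<longleftrightarrow> (\<forall>\<delta>>0. \<forall>\<eta>\<ge>\<delta>. baker_ericksen_at pr pt \<delta> \<eta>)"

section \<open>The stored energy function\<close>

definition is_stored_energy ::
    "(real \<Rightarrow> real \<Rightarrow> real) \<Rightarrow> (real \<Rightarrow> real \<Rightarrow> real) \<Rightarrow> (real \<Rightarrow> real \<Rightarrow> real) \<Rightarrow> bool" where
  "is_stored_energy pr pt w \<longleftrightarrow> w 1 1 = 0 \<and>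
     (\<forall>\<delta>>0. \<forall>\<eta>>0.
        (\<lambda>d. w d \<eta>) differentiable (at \<delta>) \<and> (\<lambda>e. w \<delta> e) differentiable (at \<eta>) \<and>
        pr \<delta> \<eta> = \<delta>\<^sup>2 * deriv (\<lambda>d. w d \<eta>) \<delta> \<and>
        pt \<delta> \<eta> = pr \<delta> \<eta> + 3 / 2 * \<delta> * \<eta> * deriv (\<lambda>e. w \<delta> e) \<eta>)"

text \<open>The stored energy is determined only at positive arguments (see
  \<open>is_stored_energy_unique\<close>), so the definite description picks its values rather than
  a function on all of \<open>real\<close>.\<close>

definition stored_energy ::
    "(real \<Rightarrow> real \<Rightarrow> real) \<Rightarrow> (real \<Rightarrow> real \<Rightarrow> real) \<Rightarrow> real \<Rightarrow> real \<Rightarrow> real" where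
  "stored_energy pr pt \<delta> \<eta> = (THE v. \<exists>w. is_stored_energy pr pt w \<and> w \<delta> \<eta> = v)"

definition strong_nonneg_energy :: "(real \<Rightarrow> real \<Rightarrow> real) \<Rightarrow> bool" where
  "strong_nonneg_energy w \<longleftrightarrow> (\<forall>\<delta>>0. \<forall>\<eta>>0. w \<delta> \<eta> \<ge> 0)"

definition weak_nonneg_energy :: "(real \<Rightarrow> real \<Rightarrow> real) \<Rightarrow> bool" where
  "weak_nonneg_energy w \<longleftrightarrow> (\<forall>\<delta>>0. \<forall>\<eta>\<ge>\<delta>. w \<delta> \<eta> \<ge> 0)"

lemma is_stored_energy_unique:
  assumes "is_stored_energy pr pt w" "is_stored_energy pr pt w'" "\<delta> > 0" "\<eta> > 0"
  shows "w \<delta> \<eta> = w' \<delta> \<eta>"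
proof -
  have const: "f a = f b"
    if "\<And>x. x > 0 \<Longrightarrow> (f has_real_derivative 0) (at x)" "a > 0" "b > 0"
    for f :: "real \<Rightarrow> real" and a b
    by (rule has_field_derivative_zero_constant[of "{0<..}" f, THEN exE])
       (use that in \<open>auto intro: has_field_derivative_at_within\<close>)
  have D: "((\<lambda>d. w d e - w' d e) has_real_derivative 0) (at d)" if "d > 0" "e > 0" for d e
  proof -
    have *: "((\<lambda>d. w d e) has_real_derivative pr d e / d\<^sup>2) (at d)"
      if "is_stored_energy pr pt w" for w
    proof -
      have "((\<lambda>d. w d e) has_real_derivative deriv (\<lambda>d. w d e) d) (at d)"
        using that \<open>d > 0\<close> \<open>e > 0\<close> unfolding is_stored_energy_def
        by (metis DERIV_imp_deriv real_differentiable_def)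
      moreover have "deriv (\<lambda>d. w d e) d = pr d e / d\<^sup>2"
        using that \<open>d > 0\<close> \<open>e > 0\<close> unfolding is_stored_energy_def by auto
      ultimately show ?thesis by simp
    qed
    show ?thesis
      using DERIV_diff[OF *[OF assms(1)] *[OF assms(2)]] by simp
  qed
  have E: "((\<lambda>e. w d e - w' d e) has_real_derivative 0) (at e)" if "d > 0" "e > 0" for d e
  proof -
    have *: "((\<lambda>e. w d e) has_real_derivative (pt d e - pr d e) / (3 / 2 * d * e)) (at e)"
      if "is_stored_energy pr pt w" for w
    proof -
      have "((\<lambda>e. w d e) has_real_derivative deriv (\<lambda>e. w d e) e) (at e)"
        using that \<open>d > 0\<close> \<open>e > 0\<close> unfolding is_stored_energy_def
        by (metis DERIV_imp_deriv real_differentiable_def)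
      moreover have "deriv (\<lambda>e. w d e) e = (pt d e - pr d e) / (3 / 2 * d * e)"
        using that \<open>d > 0\<close> \<open>e > 0\<close> unfolding is_stored_energy_def by auto
      ultimately show ?thesis by simp
    qed
    show ?thesis
      using DERIV_diff[OF *[OF assms(1)] *[OF assms(2)]] by simp
  qed
  have "w \<delta> \<eta> - w' \<delta> \<eta> = w 1 \<eta> - w' 1 \<eta>"
    by (rule const[of "\<lambda>d. w d \<eta> - w' d \<eta>"]) (use D assms in auto)
  also have "\<dots> = w 1 1 - w' 1 1"
    by (rule const[of "\<lambda>e. w 1 e - w' 1 e"]) (use E assms in auto)
  also have "\<dots> = 0"
    using assms by (simp add: is_stored_energy_def)
  finally show ?thesis by simp
qed

lemma stored_energy_eq:
  assumes "is_stored_energy pr pt w" "\<delta> > 0" "\<eta> > 0"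
  shows "stored_energy pr pt \<delta> \<eta> = w \<delta> \<eta>"
  unfolding stored_energy_def
  using assms is_stored_energy_unique by (intro the_equality) blast+

section \<open>Explicit form of the polytropic stored energy\<close>

definition S :: "real \<Rightarrow> real \<Rightarrow> real \<Rightarrow> real" where
  "S \<nu> \<beta> y =
     (if \<beta> \<noteq> 1 then
        (1 - \<nu>) / (1 + \<nu>) * (y powr (\<beta> - 1) / (\<beta> * (\<beta> - 1)) + inverse y / \<beta> - 1 / (\<beta> - 1))
      else (1 - \<nu>) / (1 + \<nu>) * (ln y + inverse y - 1))"

definition w_explicit :: "real \<Rightarrow> real \<Rightarrow> real \<Rightarrow> real \<Rightarrow> real \<Rightarrow> real \<Rightarrow> real" where
  "w_explicit \<kappa> \<nu> \<gamma> \<beta> \<delta> \<eta> =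
     \<kappa> * (if \<gamma> \<noteq> 1 then
            \<eta> powr (\<gamma> - 1) * (3 * S \<nu> \<beta> (\<delta> / \<eta>) - 1 / \<gamma> * inverse (\<delta> / \<eta>) + 1 / (\<gamma> - 1))
            + inverse \<delta> / \<gamma> - 1 / (\<gamma> - 1)
          else
            3 * S \<nu> \<beta> (\<delta> / \<eta>) - inverse (\<delta> / \<eta>) - ln (\<delta> / \<eta>) + ln \<delta> + inverse \<delta>)"

lemma is_stored_energyI:
  assumes "w 1 1 = 0"
    and "\<And>\<delta> \<eta>. \<delta> > 0 \<Longrightarrow> \<eta> > 0 \<Longrightarrow> ((\<lambda>d. w d \<eta>) has_real_derivative pr \<delta> \<eta> / \<delta>\<^sup>2) (at \<delta>)"
    and "\<And>\<delta> \<eta>. \<delta> > 0 \<Longrightarrow> \<eta> > 0 \<Longrightarrow>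
      ((\<lambda>e. w \<delta> e) has_real_derivative (pt \<delta> \<eta> - pr \<delta> \<eta>) / (3 / 2 * \<delta> * \<eta>)) (at \<eta>)"
  shows "is_stored_energy pr pt w"
  unfolding is_stored_energy_def
proof (intro conjI allI impI)
  fix \<delta> \<eta> :: real assume pos: "\<delta> > 0" "\<eta> > 0"
  show "(\<lambda>d. w d \<eta>) differentiable (at \<delta>)" "(\<lambda>e. w \<delta> e) differentiable (at \<eta>)"
    using assms(2,3)[OF pos] unfolding real_differentiable_def by blast+
  show "pr \<delta> \<eta> = \<delta>\<^sup>2 * deriv (\<lambda>d. w d \<eta>) \<delta>"
    unfolding DERIV_imp_deriv[OF assms(2)[OF pos]] using pos by simp
  show "pt \<delta> \<eta> = pr \<delta> \<eta> + 3 / 2 * \<delta> * \<eta> * deriv (\<lambda>e. w \<delta> e) \<eta>"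
    unfolding DERIV_imp_deriv[OF assms(3)[OF pos]] using pos by (simp add: field_simps)
qed (fact assms(1))

lemma S_has_derivative:
  assumes "y > 0" "\<beta> \<noteq> 0"
  shows "(S \<nu> \<beta> has_real_derivative (1 - \<nu>) / (1 + \<nu>) * (y powr \<beta> - 1) / (\<beta> * y\<^sup>2)) (at y)"
proof (cases "\<beta> = 1")
  case True
  define a where "a = (1 - \<nu>) / (1 + \<nu>)"
  have "((\<lambda>y. a * (ln y + inverse y - 1)) has_real_derivative a * (1 / y - 1 / y\<^sup>2)) (at y)"
    using assms by (auto intro!: derivative_eq_intros simp: power2_eq_square inverse_eq_divide)
  also have "a * (1 / y - 1 / y\<^sup>2) = a * (y powr \<beta> - 1) / (\<beta> * y\<^sup>2)"
    using assms True by (simp add: field_simps power2_eq_square)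
  finally show ?thesis
    using True by (simp add: S_def[abs_def] a_def)
next
  case False
  define a where "a = (1 - \<nu>) / (1 + \<nu>)"
  have [simp]: "y powr (\<beta> - 2) = y powr \<beta> / y\<^sup>2"
    using assms by (simp add: powr_diff)
  have "((\<lambda>y. a * (y powr (\<beta> - 1) / (\<beta> * (\<beta> - 1)) + inverse y / \<beta> - 1 / (\<beta> - 1)))
          has_real_derivative a * ((\<beta> - 1) * y powr (\<beta> - 2) / (\<beta> * (\<beta> - 1)) - 1 / y\<^sup>2 / \<beta>)) (at y)"
  proof -
    have "((\<lambda>y. y powr (\<beta> - 1)) has_real_derivative (\<beta> - 1) * y powr (\<beta> - 2)) (at y)"
      using has_real_derivative_powr[OF assms(1), of "\<beta> - 1"] by simp
    moreover have "(inverse has_real_derivative - (1 / y\<^sup>2)) (at y)"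
      using assms by (auto intro!: derivative_eq_intros simp: power2_eq_square inverse_eq_divide)
    ultimately show ?thesis
      using assms False
      by (auto intro!: derivative_eq_intros simp: power2_eq_square inverse_eq_divide)
  qed
  also have "a * ((\<beta> - 1) * y powr (\<beta> - 2) / (\<beta> * (\<beta> - 1)) - 1 / y\<^sup>2 / \<beta>)
             = a * (y powr \<beta> - 1) / (\<beta> * y\<^sup>2)"
    using assms False by (simp add: divide_simps)
  finally show ?thesis
    using False by (simp add: S_def[abs_def] a_def)
qed

lemma p_rad_simp:
  assumes "-1 < \<nu>" "\<nu> \<le> 1 / 2" "\<gamma> > 0" "\<beta> \<noteq> 0"
    and "\<beta> \<le> 3 * ((1 - \<nu>) / (1 + \<nu>)) * \<gamma>"
  shows "p_rad \<kappa> \<nu> \<gamma> \<beta> \<delta> \<eta> =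
    \<kappa> * (3 * ((1 - \<nu>) / (1 + \<nu>)) * ((\<delta> / \<eta>) powr \<beta> - 1) * \<eta> powr \<gamma> / \<beta> + \<eta> powr \<gamma> / \<gamma> - 1 / \<gamma>)"
proof -
  define a where "a = (1 - \<nu>) / (1 + \<nu>)"
  have a: "a > 0" using assms by (simp add: a_def)
  have inv: "(1 + \<nu>) / (1 - \<nu>) = 1 / a" by (simp add: a_def)
  have "y_b \<nu> \<gamma> \<beta> powr \<beta> = 1 - \<beta> / (3 * \<gamma>) * (1 / a)"
    using assms a unfolding y_b_def inv powr_powr
    by (simp add: field_simps flip: a_def)
  then have "p_rad \<kappa> \<nu> \<gamma> \<beta> \<delta> \<eta> =
    \<kappa> * (3 * a / \<beta> * ((\<delta> / \<eta>) powr \<beta> - (1 - \<beta> / (3 * \<gamma>) * (1 / a))) * \<eta> powr \<gamma> - 1 / \<gamma>)"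
    by (simp add: p_rad_def a_def mult.commute)
  also have "\<dots> = \<kappa> * (3 * a * ((\<delta> / \<eta>) powr \<beta> - 1) * \<eta> powr \<gamma> / \<beta> + \<eta> powr \<gamma> / \<gamma> - 1 / \<gamma>)"
    using a assms by (simp add: field_simps)
  finally show ?thesis by (simp add: a_def)
qed

lemma w_explicit_is_stored_energy:
  assumes "-1 < \<nu>" "\<nu> \<le> 1 / 2" "\<gamma> > 0" "\<beta> \<noteq> 0"
    and "\<beta> \<le> 3 * ((1 - \<nu>) / (1 + \<nu>)) * \<gamma>"
  shows "is_stored_energy (p_rad \<kappa> \<nu> \<gamma> \<beta>) (p_tan \<kappa> \<nu> \<gamma> \<beta>) (w_explicit \<kappa> \<nu> \<gamma> \<beta>)"
proof (rule is_stored_energyI)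
  show "w_explicit \<kappa> \<nu> \<gamma> \<beta> 1 1 = 0"
  proof -
    have "S \<nu> \<beta> 1 = 0"
      using assms(4) by (simp add: S_def divide_simps)
    then show ?thesis by (simp add: w_explicit_def)
  qed
next
  define a where "a = (1 - \<nu>) / (1 + \<nu>)"
  fix \<delta> \<eta> :: real assume pos: "\<delta> > 0" "\<eta> > 0"
  define y where "y = \<delta> / \<eta>"
  define P where "P = y powr \<beta>"
  define S' where "S' = a * (P - 1) / (\<beta> * y\<^sup>2)"
  define G where "G = \<eta> powr \<gamma>"
  have y: "y > 0" and \<delta>: "\<delta> = y * \<eta>" using pos by (auto simp: y_def)
  have G: "\<eta> powr (\<gamma> - 1) = G / \<eta>" "\<eta> powr (\<gamma> - 2) = G / \<eta>\<^sup>2"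
    using pos by (simp_all add: G_def powr_diff)
  have DS: "(S \<nu> \<beta> has_real_derivative S') (at y)"
    using S_has_derivative[OF y assms(4)] by (simp add: S'_def P_def a_def)
  have dS: "((\<lambda>d. S \<nu> \<beta> (d / \<eta>)) has_real_derivative S' * (1 / \<eta>)) (at \<delta>)"
    by (rule DERIV_chain2[where g = "\<lambda>d. d / \<eta>"])
       (use DS pos in \<open>auto simp: y_def intro!: derivative_eq_intros\<close>)
  have eS: "((\<lambda>e. S \<nu> \<beta> (\<delta> / e)) has_real_derivative S' * (- \<delta> / \<eta>\<^sup>2)) (at \<eta>)"
    by (rule DERIV_chain2[where g = "\<lambda>e. \<delta> / e"])
       (use DS pos in \<open>auto simp: y_def power2_eq_square intro!: derivative_eq_intros\<close>)
  have pr: "p_rad \<kappa> \<nu> \<gamma> \<beta> \<delta> \<eta> = \<kappa> * (3 * a * (P - 1) * G / \<beta> + G / \<gamma> - 1 / \<gamma>)"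
    using p_rad_simp[OF assms] by (simp add: a_def P_def y_def G_def)
  show "((\<lambda>d. w_explicit \<kappa> \<nu> \<gamma> \<beta> d \<eta>) has_real_derivative p_rad \<kappa> \<nu> \<gamma> \<beta> \<delta> \<eta> / \<delta>\<^sup>2) (at \<delta>)"
  proof (cases "\<gamma> = 1")
    case True
    have "G = \<eta>" using True pos by (simp add: G_def)
    have "((\<lambda>d. w_explicit \<kappa> \<nu> \<gamma> \<beta> d \<eta>) has_real_derivative
        \<kappa> * (3 * (S' * (1 / \<eta>)) + \<eta> / \<delta>\<^sup>2 - 1 / \<delta>\<^sup>2)) (at \<delta>)"
      unfolding w_explicit_def using True pos
      by (auto intro!: derivative_eq_intros dS simp: field_simps power2_eq_square)
    also have "\<kappa> * (3 * (S' * (1 / \<eta>)) + \<eta> / \<delta>\<^sup>2 - 1 / \<delta>\<^sup>2) = p_rad \<kappa> \<nu> \<gamma> \<beta> \<delta> \<eta> / \<delta>\<^sup>2"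
      unfolding pr unfolding S'_def True \<open>G = \<eta>\<close> \<delta> using y pos assms(4)
      by (simp add: field_simps power2_eq_square)
    finally show ?thesis .
  next
    case False
    have "((\<lambda>d. w_explicit \<kappa> \<nu> \<gamma> \<beta> d \<eta>) has_real_derivative
        \<kappa> * (G / \<eta> * (3 * (S' * (1 / \<eta>)) + 1 / \<gamma> * (\<eta> / \<delta>\<^sup>2)) - 1 / \<delta>\<^sup>2 / \<gamma>)) (at \<delta>)"
    proof -
      have dX: "((\<lambda>d. 3 * S \<nu> \<beta> (d / \<eta>) - 1 / \<gamma> * inverse (d / \<eta>) + 1 / (\<gamma> - 1))
          has_real_derivative 3 * (S' * (1 / \<eta>)) + 1 / \<gamma> * (\<eta> / \<delta>\<^sup>2)) (at \<delta>)"
        using pos assms(3) by (auto intro!: derivative_eq_intros dS simp: field_simps power2_eq_square)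
      have dI: "((\<lambda>d. inverse d / \<gamma>) has_real_derivative - (1 / \<delta>\<^sup>2 / \<gamma>)) (at \<delta>)"
        using pos assms(3) by (auto intro!: derivative_eq_intros simp: field_simps power2_eq_square)
      have "((\<lambda>d. \<kappa> * (\<eta> powr (\<gamma> - 1) *
            (3 * S \<nu> \<beta> (d / \<eta>) - 1 / \<gamma> * inverse (d / \<eta>) + 1 / (\<gamma> - 1))
            + inverse d / \<gamma> - 1 / (\<gamma> - 1))) has_real_derivative
          \<kappa> * (G / \<eta> * (3 * (S' * (1 / \<eta>)) + 1 / \<gamma> * (\<eta> / \<delta>\<^sup>2)) - 1 / \<delta>\<^sup>2 / \<gamma>)) (at \<delta>)"
        using DERIV_cmult[OF DERIV_diff[OF DERIV_add[OF DERIV_cmult[OF dX] dI] DERIV_const],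
          of \<kappa> "\<eta> powr (\<gamma> - 1)"] unfolding G by simp
      then show ?thesis
        using False by (simp add: w_explicit_def)
    qed
    also have "\<kappa> * (G / \<eta> * (3 * (S' * (1 / \<eta>)) + 1 / \<gamma> * (\<eta> / \<delta>\<^sup>2)) - 1 / \<delta>\<^sup>2 / \<gamma>)
        = p_rad \<kappa> \<nu> \<gamma> \<beta> \<delta> \<eta> / \<delta>\<^sup>2"
      unfolding pr unfolding S'_def \<delta> using y pos assms(3,4)
      by (simp add: field_simps power2_eq_square)
    finally show ?thesis .
  qed
  define T where "T = (1 - y) * Q \<nu> \<gamma> \<beta> y"
  have pt: "p_tan \<kappa> \<nu> \<gamma> \<beta> \<delta> \<eta> - p_rad \<kappa> \<nu> \<gamma> \<beta> \<delta> \<eta> = 3 * \<kappa> * T * G"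
    by (simp add: p_tan_def T_def y_def G_def)
  have T: "T = (if \<beta> \<noteq> 1 then 3 * a * (\<beta> - \<gamma>) / (2 * \<beta> * (\<beta> - 1)) * (1 - P)
                   + (1 - y) * (3 * a * (\<gamma> - 1) / (2 * (\<beta> - 1)) - 1 / 2)
                 else 3 * a * (\<gamma> - 1) / 2 * (y * ln y) + (1 - y) * (3 * a * \<gamma> / 2 - 1 / 2))"
  proof (cases "y = 1")
    case True
    then show ?thesis by (simp add: T_def P_def)
  next
    case False
    have "Q \<nu> \<gamma> \<beta> y =
      (if \<beta> \<noteq> 1 then 3 * a * (\<beta> - \<gamma>) / (2 * \<beta> * (\<beta> - 1)) * ((1 - P) / (1 - y))
                   + (3 * a * (\<gamma> - 1) / (2 * (\<beta> - 1)) - 1 / 2)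
       else 3 * a * (\<gamma> - 1) / 2 * (y * ln y / (1 - y)) + (3 * a * \<gamma> / 2 - 1 / 2))"
      using False by (simp add: Q_def Q_formula_def a_def P_def algebra_simps)
    moreover have "(1 - y) * (u * (v / (1 - y)) + z) = u * v + (1 - y) * z" for u v z
      using False by (simp add: field_simps)
    ultimately show ?thesis
      unfolding T_def by presburger
  qed
  have Sy: "S \<nu> \<beta> y = (if \<beta> \<noteq> 1 then a * (P / y / (\<beta> * (\<beta> - 1)) + 1 / y / \<beta> - 1 / (\<beta> - 1))
                           else a * (ln y + 1 / y - 1))"
    using y by (simp add: S_def a_def P_def powr_diff inverse_eq_divide)
  have *: "(\<gamma> - 1) * 3 * S \<nu> \<beta> y - (\<gamma> - 1) / (\<gamma> * y) + 1 - (3 * S' + 1 / (\<gamma> * y\<^sup>2)) * y = 2 * T / y"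
  proof (cases "\<beta> = 1")
    case True
    then have "P = y" using y by (simp add: P_def)
    then show ?thesis
      unfolding Sy T S'_def using True y assms(3)
      by (simp add: divide_simps power2_eq_square) (simp add: algebra_simps)
  next
    case False
    then have "\<beta> - 1 \<noteq> 0" by simp
    then show ?thesis
      unfolding Sy T S'_def using False y assms(3,4)
      by (simp add: divide_simps power2_eq_square) (simp add: algebra_simps)
  qed
  show "((\<lambda>e. w_explicit \<kappa> \<nu> \<gamma> \<beta> \<delta> e) has_real_derivative
      (p_tan \<kappa> \<nu> \<gamma> \<beta> \<delta> \<eta> - p_rad \<kappa> \<nu> \<gamma> \<beta> \<delta> \<eta>) / (3 / 2 * \<delta> * \<eta>)) (at \<eta>)"
  proof (cases "\<gamma> = 1")
    case True
    have "G = \<eta>" using True pos by (simp add: G_def)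
    have "((\<lambda>e. w_explicit \<kappa> \<nu> \<gamma> \<beta> \<delta> e) has_real_derivative
        \<kappa> * (3 * (S' * (- \<delta> / \<eta>\<^sup>2)) - 1 / \<delta> + 1 / \<eta>)) (at \<eta>)"
      unfolding w_explicit_def using True pos
      by (auto intro!: derivative_eq_intros eS simp: field_simps power2_eq_square)
    also have "\<kappa> * (3 * (S' * (- \<delta> / \<eta>\<^sup>2)) - 1 / \<delta> + 1 / \<eta>)
        = \<kappa> / \<eta> * ((\<gamma> - 1) * 3 * S \<nu> \<beta> y - (\<gamma> - 1) / (\<gamma> * y) + 1 - (3 * S' + 1 / (\<gamma> * y\<^sup>2)) * y)"
      unfolding True \<delta> using y pos
      by (simp add: field_simps power2_eq_square)
    also have "\<dots> = (3 * \<kappa> * T * G) / (3 / 2 * \<delta> * \<eta>)"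
      unfolding * \<open>G = \<eta>\<close> \<delta> using y pos by (simp add: field_simps)
    finally show ?thesis unfolding pt .
  next
    case False
    define X where "X = 3 * S \<nu> \<beta> y - 1 / \<gamma> * (1 / y) + 1 / (\<gamma> - 1)"
    have eX: "((\<lambda>e. 3 * S \<nu> \<beta> (\<delta> / e) - 1 / \<gamma> * inverse (\<delta> / e) + 1 / (\<gamma> - 1))
        has_real_derivative 3 * (S' * (- \<delta> / \<eta>\<^sup>2)) - 1 / \<gamma> * (1 / \<delta>)) (at \<eta>)"
      using pos assms(3) by (auto intro!: derivative_eq_intros eS simp: field_simps)
    have eG: "((\<lambda>e. e powr (\<gamma> - 1)) has_real_derivative (\<gamma> - 1) * (G / \<eta>\<^sup>2)) (at \<eta>)"
      using has_real_derivative_powr[OF pos(2), of "\<gamma> - 1"] by (simp flip: G(2))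
    have X: "3 * S \<nu> \<beta> (\<delta> / \<eta>) - 1 / \<gamma> * inverse (\<delta> / \<eta>) + 1 / (\<gamma> - 1) = X"
      by (simp add: X_def y_def)
    have "((\<lambda>e. \<kappa> * (e powr (\<gamma> - 1) * (3 * S \<nu> \<beta> (\<delta> / e) - 1 / \<gamma> * inverse (\<delta> / e) + 1 / (\<gamma> - 1))
              + inverse \<delta> / \<gamma> - 1 / (\<gamma> - 1))) has_real_derivative
        \<kappa> * ((\<gamma> - 1) * (G / \<eta>\<^sup>2) * X + (3 * (S' * (- \<delta> / \<eta>\<^sup>2)) - 1 / \<gamma> * (1 / \<delta>)) * (G / \<eta>))) (at \<eta>)"
      using DERIV_cmult[OF DERIV_diff[OF DERIV_add[OF DERIV_mult[OF eG eX] DERIV_const] DERIV_const], of \<kappa>]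
      unfolding X G by simp
    also have "\<kappa> * ((\<gamma> - 1) * (G / \<eta>\<^sup>2) * X + (3 * (S' * (- \<delta> / \<eta>\<^sup>2)) - 1 / \<gamma> * (1 / \<delta>)) * (G / \<eta>))
        = \<kappa> * G / \<eta>\<^sup>2 * ((\<gamma> - 1) * X - (3 * S' + 1 / (\<gamma> * y\<^sup>2)) * y)"
      unfolding \<delta> using y pos assms(3)
      by (simp add: field_simps power2_eq_square)
    also have "(\<gamma> - 1) * X = (\<gamma> - 1) * 3 * S \<nu> \<beta> y - (\<gamma> - 1) / (\<gamma> * y) + 1"
      using False y assms(3) by (simp add: X_def distrib_left right_diff_distrib)
    also have "\<kappa> * G / \<eta>\<^sup>2 * (\<dots> - (3 * S' + 1 / (\<gamma> * y\<^sup>2)) * y)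
        = (3 * \<kappa> * T * G) / (3 / 2 * \<delta> * \<eta>)"
      unfolding * \<delta> using y pos by (simp add: field_simps power2_eq_square)
    finally show ?thesis unfolding pt w_explicit_def using False by simp
  qed
qed

lemma stored_energy_explicit:
  assumes "-1 < \<nu>" "\<nu> \<le> 1 / 2" "\<gamma> > 0" "\<beta> \<noteq> 0"
    and "\<beta> \<le> 3 * ((1 - \<nu>) / (1 + \<nu>)) * \<gamma>" and "\<delta> > 0" "\<eta> > 0"
  shows "stored_energy (p_rad \<kappa> \<nu> \<gamma> \<beta>) (p_tan \<kappa> \<nu> \<gamma> \<beta>) \<delta> \<eta> = w_explicit \<kappa> \<nu> \<gamma> \<beta> \<delta> \<eta>"
  using stored_energy_eq w_explicit_is_stored_energy assms by blast

end

theory Submission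
  imports Defs
begin

text \<open>
  Write \<open>a = (1 - \<nu>) / (1 + \<nu>)\<close>; the range of \<open>\<nu>\<close> makes \<open>3 * a \<ge> 1\<close>, and the second entry of
  the minimum is \<open>3 * a * (\<gamma> - 1) + 1\<close>.

  Since \<open>\<eta> - \<delta> = \<eta> * (1 - y)\<close> with \<open>y = \<delta> / \<eta>\<close>, the Baker-Ericksen quotient is a positive multiple
  of \<open>Q y\<close>, so both versions of the inequality are statements about the sign of \<open>Q\<close> on \<open>{0<..1}\<close> or
  on \<open>{0<..}\<close>. The key point is that \<open>Q y\<close> is the average over the interval between \<open>y\<close> and \<open>1\<close> of
  \<open>q t = 3 * a / 2 * (1 + (\<beta> - \<gamma>) * L t) - 1 / 2\<close>, where \<open>L\<close> is the antiderivative of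
  \<open>t powr (\<beta> - 2)\<close> that vanishes at \<open>1\<close>. As \<open>q\<close> is monotone, with \<open>q 1 = (3 * a - 1) / 2 \<ge> 0\<close>, so is
  \<open>Q\<close>, and its sign is decided at the ends of the interval:

  \<^item> If \<open>\<beta> \<ge> \<gamma>\<close>, then \<open>Q\<close> is increasing, and its limit at \<open>0\<close> is \<open>(3 * a * \<gamma> / \<beta> - 1) / 2\<close>, which is
    non-negative exactly by the standing bound on \<open>\<beta>\<close>. So \<open>Q\<close> is non-negative throughout.
  \<^item> If \<open>\<beta> < \<gamma>\<close>, then \<open>Q\<close> is decreasing, hence non-negative on \<open>{0<..1}\<close>. It stays non-negative on
    \<open>{1<..}\<close> iff its limit at infinity is non-negative. This limit is minus infinity for
    \<open>\<beta> \<ge> 1\<close>, and \<open>(3 * a * (1 - \<gamma>) / (1 - \<beta>) - 1) / 2\<close> for \<open>\<beta> < 1\<close>; so the condition is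
    \<open>\<beta> \<ge> 3 * a * (\<gamma> - 1) + 1\<close>. It can only hold for \<open>\<gamma> < 1\<close>, because
    \<open>3 * a * (\<gamma> - 1) + 1 - \<gamma> = (3 * a - 1) * (\<gamma> - 1)\<close>.

  The energy condition adds nothing. By the Baker-Ericksen inequality \<open>\<partial>\<^sub>\<eta> w\<close> has the sign of
  \<open>\<eta> - \<delta>\<close>, so \<open>w \<delta> \<eta> \<ge> w \<delta> \<delta>\<close> wherever that inequality holds between \<open>\<delta>\<close> and \<open>\<eta>\<close>. On the
  diagonal \<open>w\<close> is a positive multiple of the function \<open>S\<close> with exponent \<open>\<gamma>\<close>, whose minimum is
  \<open>S 1 = 0\<close>.
\<close>

section \<open>The antiderivative of a power\<close>

text \<open>The antiderivative of \<open>t powr (p - 1)\<close> that vanishes at \<open>1\<close>, known as the Box-Cox transform.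
  It absorbs the case distinction \<open>\<beta> = 1\<close> in the constitutive function.\<close>

definition box_cox :: "real \<Rightarrow> real \<Rightarrow> real" where
  "box_cox p t = (if p = 0 then ln t else (t powr p - 1) / p)"

lemma box_cox_1 [simp]: "box_cox p 1 = 0"
  by (simp add: box_cox_def)

lemma box_cox_has_derivative:
  assumes "t > 0"
  shows "(box_cox p has_real_derivative t powr (p - 1)) (at t)"
proof (cases "p = 0")
  case True
  have "(ln has_real_derivative 1 / t) (at t)"
    using assms by (auto intro!: derivative_eq_intros)
  then show ?thesis
    using True assms by (simp add: box_cox_def[abs_def] powr_minus_divide)
next
  case False
  have "((\<lambda>t. (t powr p - 1) / p) has_real_derivative (p * t powr (p - 1)) / p) (at t)"
    using DERIV_cdivide[OF DERIV_diff[OF has_real_derivative_powr[OF assms, of p] DERIV_const[of 1]], of p]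
    by simp
  then show ?thesis
    using False by (simp add: box_cox_def[abs_def])
qed

lemma box_cox_mono:
  assumes "0 < s" "s \<le> t"
  shows "box_cox p s \<le> box_cox p t"
  by (rule DERIV_nonneg_imp_nondecreasing[OF assms(2)])
     (meson assms(1) box_cox_has_derivative less_le_trans powr_ge_zero)

lemma one_plus_mult_box_cox:
  assumes "t > 0"
  shows "1 + p * box_cox p t = t powr p"
  using assms by (simp add: box_cox_def)

text \<open>The transform attains every value that is compatible with \<open>t powr p > 0\<close>.\<close>

lemma box_cox_attains:
  assumes "1 + p * M > 0"
  obtains t where "t > 0" "box_cox p t = M"
proof (cases "p = 0")
  case True
  then show ?thesis
    using that[of "exp M"] by (simp add: box_cox_def)
next
  case False
  have "((1 + p * M) powr (1 / p)) powr p = 1 + p * M"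
    using assms False by (simp add: powr_powr)
  then show ?thesis
    using that[of "(1 + p * M) powr (1 / p)"] assms False by (simp add: box_cox_def)
qed

section \<open>The shear stress as an average\<close>

text \<open>The shear stress \<open>(1 - y) * Q y\<close>, rearranged so that the sign of each term is visible when
  \<open>y < 1\<close> and \<open>0 < \<gamma> \<le> \<beta> \<le> 3 * a * \<gamma>\<close>; the first coefficient is the limit of \<open>Q\<close> at \<open>0\<close>.\<close>

definition shear_stress :: "real \<Rightarrow> real \<Rightarrow> real \<Rightarrow> real \<Rightarrow> real" where
  "shear_stress a \<gamma> \<beta> y =
     (3 * a * \<gamma> / \<beta> - 1) / 2 * (1 - y) - 3 * a / 2 * ((\<beta> - \<gamma>) / \<beta>) * (y * box_cox (\<beta> - 1) y)"

text \<open>The monotone function of which \<open>Q\<close> is the average.\<close>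

definition shear_density :: "real \<Rightarrow> real \<Rightarrow> real \<Rightarrow> real \<Rightarrow> real" where
  "shear_density a \<gamma> \<beta> t = 3 * a / 2 * (1 + (\<beta> - \<gamma>) * box_cox (\<beta> - 1) t) - 1 / 2"

lemma shear_stress_1 [simp]: "shear_stress a \<gamma> \<beta> 1 = 0"
  by (simp add: shear_stress_def)

lemma shear_stress_has_derivative:
  assumes "t > 0" "\<beta> \<noteq> 0"
  shows "(shear_stress a \<gamma> \<beta> has_real_derivative - shear_density a \<gamma> \<beta> t) (at t)"
proof -
  define L where "L = box_cox (\<beta> - 1) t"
  have dL: "((\<lambda>y. y * box_cox (\<beta> - 1) y) has_real_derivative 1 + \<beta> * L) (at t)"
  proof -
    have "t * t powr (\<beta> - 1 - 1) = t powr (\<beta> - 1)"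
      using assms by (simp add: powr_diff power2_eq_square)
    also have "\<dots> = 1 + (\<beta> - 1) * L"
      unfolding L_def by (rule one_plus_mult_box_cox[symmetric]) fact
    finally have "1 * L + t powr (\<beta> - 1 - 1) * t = 1 + \<beta> * L"
      by (simp add: algebra_simps)
    then show ?thesis
      using DERIV_mult[OF DERIV_ident box_cox_has_derivative[OF assms(1), of "\<beta> - 1"]]
      by (simp add: L_def)
  qed
  have "((\<lambda>y. (3 * a * \<gamma> / \<beta> - 1) / 2 * (1 - y)
        - 3 * a / 2 * ((\<beta> - \<gamma>) / \<beta>) * (y * box_cox (\<beta> - 1) y)) has_real_derivative
      (3 * a * \<gamma> / \<beta> - 1) / 2 * (0 - 1) - 3 * a / 2 * ((\<beta> - \<gamma>) / \<beta>) * (1 + \<beta> * L)) (at t)"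
    by (intro DERIV_diff DERIV_cmult DERIV_const DERIV_ident dL)
  also have "(3 * a * \<gamma> / \<beta> - 1) / 2 * (0 - 1) - 3 * a / 2 * ((\<beta> - \<gamma>) / \<beta>) * (1 + \<beta> * L)
      = - shear_density a \<gamma> \<beta> t"
    using assms(2) by (simp add: shear_density_def L_def field_simps)
  finally show ?thesis
    by (simp add: shear_stress_def[abs_def])
qed

lemma shear_stress_mean_value:
  assumes "0 < x" "x < y" "\<beta> \<noteq> 0"
  obtains \<xi> where "x < \<xi>" "\<xi> < y"
    "shear_stress a \<gamma> \<beta> y - shear_stress a \<gamma> \<beta> x = - (y - x) * shear_density a \<gamma> \<beta> \<xi>"
proof -
  have "\<exists>\<xi>. x < \<xi> \<and> \<xi> < y \<and> shear_stress a \<gamma> \<beta> y - shear_stress a \<gamma> \<beta> x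
      = (y - x) * - shear_density a \<gamma> \<beta> \<xi>"
    by (rule MVT2) (use assms shear_stress_has_derivative in auto)
  then show ?thesis
    using that by (metis mult_minus_left mult_minus_right)
qed

lemma shear_stress_eq_Q_formula:
  assumes "a = (1 - \<nu>) / (1 + \<nu>)" "\<beta> \<noteq> 0" "y > 0" "y \<noteq> 1"
  shows "Q_formula \<nu> \<gamma> \<beta> y = shear_stress a \<gamma> \<beta> y / (1 - y)"
proof (cases "\<beta> = 1")
  case True
  have "Q_formula \<nu> \<gamma> \<beta> y
      = 3 * a * (\<gamma> - 1) / 2 * (y * ln y / (1 - y)) + (3 * a * \<gamma> / 2 - 1 / 2)"
    using True by (simp add: Q_formula_def assms(1) algebra_simps)
  also have "\<dots> = shear_stress a \<gamma> \<beta> y / (1 - y)"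
    using True assms(4) by (simp add: shear_stress_def box_cox_def field_simps)
  finally show ?thesis .
next
  case False
  define P where "P = y powr \<beta>"
  have "Q_formula \<nu> \<gamma> \<beta> y = 3 * a * (\<beta> - \<gamma>) / (2 * \<beta> * (\<beta> - 1)) * ((1 - P) / (1 - y))
      + (3 * a * (\<gamma> - 1) / (2 * (\<beta> - 1)) - 1 / 2)"
    using False by (simp add: Q_formula_def assms(1) P_def algebra_simps)
  also have "\<dots> = (3 * a * (\<beta> - \<gamma>) / (2 * \<beta> * (\<beta> - 1)) * (1 - P)
      + (3 * a * (\<gamma> - 1) / (2 * (\<beta> - 1)) - 1 / 2) * (1 - y)) / (1 - y)"
    using assms(4) by (simp add: add_divide_distrib)
  also have "3 * a * (\<beta> - \<gamma>) / (2 * \<beta> * (\<beta> - 1)) * (1 - P)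
      + (3 * a * (\<gamma> - 1) / (2 * (\<beta> - 1)) - 1 / 2) * (1 - y) = shear_stress a \<gamma> \<beta> y"
  proof -
    have yL: "y * box_cox (\<beta> - 1) y = (P - y) / (\<beta> - 1)"
      using False assms(3) by (simp add: box_cox_def P_def powr_diff field_simps)
    moreover have "\<beta> - 1 \<noteq> 0"
      using False by simp
    ultimately show ?thesis
      unfolding shear_stress_def yL
      using assms(2) by (simp add: divide_simps) (simp add: algebra_simps)
  qed
  finally show ?thesis .
qed

text \<open>At the removable singularity \<open>Q\<close> is a derivative of the shear stress, up to sign.\<close>

lemma Q_formula_tendsto:
  assumes "a = (1 - \<nu>) / (1 + \<nu>)" "\<beta> \<noteq> 0"
  shows "(Q_formula \<nu> \<gamma> \<beta> \<longlongrightarrow> (3 * a - 1) / 2) (at 1)"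
proof -
  have "((\<lambda>y. (shear_stress a \<gamma> \<beta> y - shear_stress a \<gamma> \<beta> 1) / (y - 1))
      \<longlongrightarrow> - shear_density a \<gamma> \<beta> 1) (at 1)"
    using shear_stress_has_derivative[of 1 \<beta> a \<gamma>] assms(2)
    by (simp add: has_field_derivative_iff)
  from tendsto_minus[OF this]
  have "((\<lambda>y. - (shear_stress a \<gamma> \<beta> y / (y - 1))) \<longlongrightarrow> (3 * a - 1) / 2) (at 1)"
    by (simp add: shear_density_def diff_divide_distrib)
  moreover have "\<forall>\<^sub>F y in at 1. - (shear_stress a \<gamma> \<beta> y / (y - 1)) = Q_formula \<nu> \<gamma> \<beta> y"
  proof -
    have "\<forall>\<^sub>F y in at (1::real). y \<in> {0<..} - {1}"
      by (rule eventually_at_in_open) auto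
    then show ?thesis
    proof eventually_elim
      case (elim y)
      then show ?case
        using shear_stress_eq_Q_formula[OF assms, of y \<gamma>] by (simp flip: divide_minus_right)
    qed
  qed
  ultimately show ?thesis
    by (rule Lim_transform_eventually)
qed

lemma Q_at_1:
  assumes "a = (1 - \<nu>) / (1 + \<nu>)" "\<beta> \<noteq> 0"
  shows "Q \<nu> \<gamma> \<beta> 1 = (3 * a - 1) / 2"
  using tendsto_Lim[OF _ Q_formula_tendsto[OF assms]] by (simp add: Q_def)

lemma isCont_Q_1:
  assumes "\<beta> \<noteq> 0"
  shows "isCont (Q \<nu> \<gamma> \<beta>) 1"
proof -
  have "(Q \<nu> \<gamma> \<beta> \<longlongrightarrow> Q \<nu> \<gamma> \<beta> 1) (at 1)"
    unfolding Q_at_1[OF refl assms]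
    by (rule Lim_transform_eventually[OF Q_formula_tendsto[OF refl assms, of \<nu> \<gamma>]])
       (auto simp: eventually_at_filter Q_def)
  then show ?thesis
    by (simp add: isCont_def)
qed

section \<open>The sign of Q\<close>

text \<open>The mean value theorem, applied to the shear stress between \<open>y\<close> and its zero at \<open>1\<close>, makes
  precise that \<open>Q y\<close> is an average of the density. A single value is enough to read off a sign.\<close>

lemma Q_mean_value:
  assumes "a = (1 - \<nu>) / (1 + \<nu>)" "\<beta> \<noteq> 0" "y > 0" "y \<noteq> 1"
  obtains \<xi> where "min y 1 < \<xi>" "\<xi> < max y 1" "Q \<nu> \<gamma> \<beta> y = shear_density a \<gamma> \<beta> \<xi>"
proof -
  have Q: "Q \<nu> \<gamma> \<beta> y = shear_stress a \<gamma> \<beta> y / (1 - y)"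
    using shear_stress_eq_Q_formula[OF assms] assms(4) by (simp add: Q_def)
  show ?thesis
  proof (cases "y < 1")
    case True
    then obtain \<xi> where "y < \<xi>" "\<xi> < 1"
        "shear_stress a \<gamma> \<beta> 1 - shear_stress a \<gamma> \<beta> y = - (1 - y) * shear_density a \<gamma> \<beta> \<xi>"
      using shear_stress_mean_value[OF assms(3) _ assms(2)] by blast
    then show ?thesis
      using that[of \<xi>] True Q by (simp add: field_simps)
  next
    case False
    then have "1 < y"
      using assms(4) by simp
    then obtain \<xi> where "1 < \<xi>" "\<xi> < y"
        "shear_stress a \<gamma> \<beta> y - shear_stress a \<gamma> \<beta> 1 = - (y - 1) * shear_density a \<gamma> \<beta> \<xi>"
      using shear_stress_mean_value[OF zero_less_one _ assms(2)] by blast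
    then show ?thesis
      using that[of \<xi>] False assms(4) Q by (simp add: field_simps)
  qed
qed

lemma shear_density_nonneg:
  assumes "3 * a \<ge> 1" "(\<beta> - \<gamma>) * box_cox (\<beta> - 1) t \<ge> 0"
  shows "shear_density a \<gamma> \<beta> t \<ge> 0"
proof -
  have "3 * a * ((\<beta> - \<gamma>) * box_cox (\<beta> - 1) t) \<ge> 0"
    using assms by (intro mult_nonneg_nonneg[of "3 * a"]) auto
  moreover have "shear_density a \<gamma> \<beta> t
      = (3 * a - 1 + 3 * a * ((\<beta> - \<gamma>) * box_cox (\<beta> - 1) t)) / 2"
    by (simp add: shear_density_def field_simps)
  ultimately show ?thesis
    using assms(1) by simp
qed

text \<open>For \<open>\<beta> < \<gamma>\<close> the density is at least its value at \<open>1\<close>. For \<open>\<beta> \<ge> \<gamma>\<close> the density itself may be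
  negative near \<open>0\<close>, and only its average over \<open>{y..1}\<close> has a sign; there the two terms of the shear
  stress are estimated separately.\<close>

lemma Q_nonneg_le_1:
  assumes a: "a = (1 - \<nu>) / (1 + \<nu>)" "3 * a \<ge> 1"
    and "\<beta> \<noteq> 0" "\<gamma> > 0" "\<beta> \<le> 3 * a * \<gamma>" and y: "0 < y" "y \<le> 1"
  shows "Q \<nu> \<gamma> \<beta> y \<ge> 0"
proof (cases "y = 1")
  case True
  then show ?thesis
    using Q_at_1[OF a(1) \<open>\<beta> \<noteq> 0\<close>, of \<gamma>] a(2) by simp
next
  case False
  show ?thesis
  proof (cases "\<beta> < \<gamma>")
    case True
    obtain \<xi> where \<xi>: "min y 1 < \<xi>" "\<xi> < max y 1" "Q \<nu> \<gamma> \<beta> y = shear_density a \<gamma> \<beta> \<xi>"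
      by (rule Q_mean_value[OF a(1) \<open>\<beta> \<noteq> 0\<close> y(1) False])
    have "box_cox (\<beta> - 1) \<xi> \<le> 0"
      using box_cox_mono[of \<xi> 1] \<xi> y by simp
    then show ?thesis
      using shear_density_nonneg[OF a(2)] True \<xi>(3) by (simp add: mult_nonpos_nonpos)
  next
    case ge: False
    have "box_cox (\<beta> - 1) y \<le> 0"
      using box_cox_mono[of y 1] y by simp
    then have "y * box_cox (\<beta> - 1) y \<le> 0"
      using y by (simp add: mult_nonneg_nonpos)
    moreover have "3 * a / 2 * ((\<beta> - \<gamma>) / \<beta>) \<ge> 0"
      using ge a(2) assms(4) by simp
    ultimately have "3 * a / 2 * ((\<beta> - \<gamma>) / \<beta>) * (y * box_cox (\<beta> - 1) y) \<le> 0"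
      by (rule mult_nonneg_nonpos[rotated])
    moreover have "(3 * a * \<gamma> / \<beta> - 1) / 2 * (1 - y) \<ge> 0"
      using ge assms(4,5) y by (intro mult_nonneg_nonneg) auto
    ultimately have "shear_stress a \<gamma> \<beta> y \<ge> 0"
      unfolding shear_stress_def by linarith
    then show ?thesis
      using shear_stress_eq_Q_formula[OF a(1) assms(3) y(1) False] y False by (simp add: Q_def)
  qed
qed

text \<open>For \<open>\<beta> \<ge> \<gamma>\<close> the density is again at least its value at \<open>1\<close>. For \<open>\<beta> < \<gamma>\<close> it decreases
  to its limit at infinity, whose sign is the threshold condition.\<close>

lemma Q_nonneg_ge_1:
  assumes a: "a = (1 - \<nu>) / (1 + \<nu>)" "3 * a \<ge> 1"
    and "\<beta> \<noteq> 0" "\<beta> \<ge> min \<gamma> (3 * a * (\<gamma> - 1) + 1)" and y: "y > 1"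
  shows "Q \<nu> \<gamma> \<beta> y \<ge> 0"
proof -
  obtain \<xi> where "min y 1 < \<xi>" and \<xi>: "Q \<nu> \<gamma> \<beta> y = shear_density a \<gamma> \<beta> \<xi>"
    by (rule Q_mean_value[OF a(1) \<open>\<beta> \<noteq> 0\<close>, of y]) (use y in auto)
  then have "\<xi> > 1"
    using y by simp
  define L where "L = box_cox (\<beta> - 1) \<xi>"
  have L: "L \<ge> 0"
    using box_cox_mono[of 1 \<xi> "\<beta> - 1"] \<open>\<xi> > 1\<close> by (simp add: L_def)
  show ?thesis
  proof (cases "\<beta> \<ge> \<gamma>")
    case True
    then show ?thesis
      using shear_density_nonneg[OF a(2)] \<xi> L by (simp add: L_def)
  next
    case False
    then have m: "3 * a * (\<gamma> - 1) + 1 \<le> \<beta>"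
      using assms(4) by (simp add: min_def split: if_splits)
    \<comment> \<open>Since \<open>(3 * a - 1) * (\<gamma> - 1) \<le> \<beta> - \<gamma> < 0\<close>, this is the case \<open>\<beta> < \<gamma> < 1\<close>, where \<open>L\<close> has
      a negative exponent and is bounded by \<open>1 / (1 - \<beta>)\<close>.\<close>
    have "(3 * a - 1) * (\<gamma> - 1) < 0"
      using m False by (simp add: algebra_simps)
    then have "\<gamma> < 1"
      using a(2) by (simp add: mult_less_0_iff)
    have "(1 - \<beta>) * L \<le> 1"
      using one_plus_mult_box_cox[of \<xi> "\<beta> - 1"] \<open>\<xi> > 1\<close> powr_ge_zero[of \<xi> "\<beta> - 1"]
      by (simp add: L_def algebra_simps)
    have "3 * a * ((\<gamma> - \<beta>) * L) * (1 - \<beta>) = 3 * a * (\<gamma> - \<beta>) * ((1 - \<beta>) * L)"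
      by simp
    also have "\<dots> \<le> 3 * a * (\<gamma> - \<beta>) * 1"
      by (intro mult_left_mono) (use \<open>(1 - \<beta>) * L \<le> 1\<close> False a(2) in auto)
    also have "\<dots> \<le> (3 * a - 1) * (1 - \<beta>)"
      using m by (simp add: algebra_simps)
    finally have "3 * a * ((\<gamma> - \<beta>) * L) \<le> 3 * a - 1"
      using \<open>\<gamma> < 1\<close> False by (simp add: mult_le_cancel_right)
    then show ?thesis
      unfolding \<xi> shear_density_def L_def[symmetric] by (simp add: algebra_simps)
  qed
qed

text \<open>Below the threshold the limit of the density at infinity is negative, so the shear stress
  eventually grows at least linearly, while \<open>1 - y\<close> is negative.\<close>

lemma Q_negative_somewhere:
  assumes a: "a = (1 - \<nu>) / (1 + \<nu>)" "3 * a \<ge> 1"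
    and "\<beta> \<noteq> 0" "\<beta> < \<gamma>" "\<beta> < 3 * a * (\<gamma> - 1) + 1"
  obtains y where "y > 1" "Q \<nu> \<gamma> \<beta> y < 0"
proof -
  \<comment> \<open>The density vanishes where \<open>L = M\<^sub>0\<close>. The threshold says that \<open>L\<close> attains values beyond
    \<open>M\<^sub>0\<close>; the increment to \<open>M\<close> is small enough to keep \<open>1 + (\<beta> - 1) * M\<close> positive.\<close>
  define M\<^sub>0 where "M\<^sub>0 = (1 - 1 / (3 * a)) / (\<gamma> - \<beta>)"
  define s where "s = 1 + (\<beta> - 1) * M\<^sub>0"
  define k where "k = 1 + \<bar>\<beta> - 1\<bar>"
  define M where "M = M\<^sub>0 + s / k"
  have "s = (3 * a * (\<gamma> - 1) + 1 - \<beta>) / (3 * a * (\<gamma> - \<beta>))"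
    using assms(2,4) by (simp add: s_def M\<^sub>0_def divide_simps) (simp add: algebra_simps)
  then have s: "s > 0"
    using assms(2,4,5) by simp
  have "M\<^sub>0 \<ge> 0"
    unfolding M\<^sub>0_def using assms(2,4) by (intro divide_nonneg_nonneg) auto
  have "M > M\<^sub>0"
    using s by (simp add: M_def k_def)
  have "1 + (\<beta> - 1) * M = s + (\<beta> - 1) * (s / k)"
    unfolding M_def distrib_left by (simp add: s_def)
  also have "\<dots> = s * ((k + (\<beta> - 1)) / k)"
    using abs_ge_zero[of "\<beta> - 1"] by (simp add: k_def field_simps)
  also have "\<dots> > 0"
    using s by (intro mult_pos_pos divide_pos_pos) (auto simp: k_def)
  finally obtain t where t: "t > 0" "box_cox (\<beta> - 1) t = M"
    using box_cox_attains by blast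
  define c where "c = - shear_density a \<gamma> \<beta> t"
  have "t > 1"
    using box_cox_mono[of t 1 "\<beta> - 1"] t \<open>M\<^sub>0 \<ge> 0\<close> \<open>M > M\<^sub>0\<close> by force
  have "c = 3 * a / 2 * (\<gamma> - \<beta>) * (M - M\<^sub>0)"
    using assms(2,4) by (simp add: c_def shear_density_def t M\<^sub>0_def field_simps)
  also have "\<dots> > 0"
    using assms(2,4) \<open>M > M\<^sub>0\<close> by (intro mult_pos_pos) auto
  finally have c: "c > 0" .
  define y where "y = t + (\<bar>shear_stress a \<gamma> \<beta> t\<bar> + 1) / c"
  have "(\<bar>shear_stress a \<gamma> \<beta> t\<bar> + 1) / c > 0"
    using c by (intro divide_pos_pos) auto
  then have "y > t"
    by (simp add: y_def)
  then obtain \<xi> where \<xi>: "t < \<xi>"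
      "shear_stress a \<gamma> \<beta> y - shear_stress a \<gamma> \<beta> t = - (y - t) * shear_density a \<gamma> \<beta> \<xi>"
    using shear_stress_mean_value[OF t(1) _ assms(3)] by blast
  have "shear_density a \<gamma> \<beta> \<xi> \<le> shear_density a \<gamma> \<beta> t"
    unfolding shear_density_def using box_cox_mono[OF t(1), of \<xi> "\<beta> - 1"] \<xi>(1) assms(2,4)
    by (intro diff_right_mono mult_left_mono add_left_mono mult_left_mono_neg) auto
  then have "(y - t) * c \<le> (y - t) * - shear_density a \<gamma> \<beta> \<xi>"
    using \<open>y > t\<close> by (intro mult_left_mono) (auto simp: c_def)
  moreover have "(y - t) * c = \<bar>shear_stress a \<gamma> \<beta> t\<bar> + 1"
    using c by (simp add: y_def)
  ultimately have "shear_stress a \<gamma> \<beta> y > 0"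
    using \<xi>(2) by (simp add: algebra_simps)
  moreover have "y > 1"
    using \<open>y > t\<close> \<open>t > 1\<close> by simp
  ultimately show ?thesis
    using that[of y] shear_stress_eq_Q_formula[OF a(1) assms(3), of y \<gamma>]
    by (simp add: Q_def divide_pos_neg)
qed

section \<open>The Baker-Ericksen inequality as a condition on Q\<close>

lemma baker_ericksen_quotient:
  assumes "\<delta> > 0" "\<eta> > 0" "\<delta> \<noteq> \<eta>"
  shows "(p_tan \<kappa> \<nu> \<gamma> \<beta> \<delta> \<eta> - p_rad \<kappa> \<nu> \<gamma> \<beta> \<delta> \<eta>) / (\<eta> - \<delta>)
    = 3 * \<kappa> * Q \<nu> \<gamma> \<beta> (\<delta> / \<eta>) * \<eta> powr (\<gamma> - 1)"
proof -
  have "1 - \<delta> / \<eta> = (\<eta> - \<delta>) / \<eta>"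
    using assms by (simp add: field_simps)
  moreover have "\<kappa> * (3 * (d / \<eta>) * q * G) / d = 3 * \<kappa> * q * (G / \<eta>)" if "d \<noteq> 0" for d q G
    using that assms by (simp add: field_simps)
  ultimately show ?thesis
    using assms by (simp add: p_tan_def powr_diff del: times_divide_eq_right times_divide_eq_left)
qed

lemma baker_ericksen_atI:
  assumes "\<kappa> > 0" "\<beta> \<noteq> 0" "\<delta> > 0" "\<eta> > 0" and Q: "Q \<nu> \<gamma> \<beta> (\<delta> / \<eta>) \<ge> 0"
  shows "baker_ericksen_at (p_rad \<kappa> \<nu> \<gamma> \<beta>) (p_tan \<kappa> \<nu> \<gamma> \<beta>) \<delta> \<eta>"
proof (cases "\<delta> = \<eta>")
  case False
  then show ?thesis
    using assms baker_ericksen_quotient[OF assms(3,4) False] by (simp add: baker_ericksen_at_def)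
next
  case True
  let ?A = "{(d, e). d > (0::real) \<and> e > (0::real) \<and> d \<noteq> e}"
  let ?F = "at (\<eta>, \<eta>) within ?A"
  have fs: "(fst \<longlongrightarrow> \<eta>) ?F" "(snd \<longlongrightarrow> \<eta>) ?F"
    by (auto intro!: tendsto_eq_intros)
  have "((\<lambda>z. fst z / snd z) \<longlongrightarrow> 1) ?F"
    using tendsto_divide[OF fs] assms(4) by simp
  then have "((\<lambda>z. 3 * \<kappa> * Q \<nu> \<gamma> \<beta> (fst z / snd z) * snd z powr (\<gamma> - 1))
      \<longlongrightarrow> 3 * \<kappa> * Q \<nu> \<gamma> \<beta> 1 * \<eta> powr (\<gamma> - 1)) ?F"
    by (intro tendsto_mult tendsto_const tendsto_powr fs isCont_tendsto_compose[OF isCont_Q_1])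
       (use assms in auto)
  moreover have "\<forall>\<^sub>F z in ?F. 3 * \<kappa> * Q \<nu> \<gamma> \<beta> (fst z / snd z) * snd z powr (\<gamma> - 1)
      = (\<lambda>(d, e). (p_tan \<kappa> \<nu> \<gamma> \<beta> d e - p_rad \<kappa> \<nu> \<gamma> \<beta> d e) / (e - d)) z"
    unfolding eventually_at_filter
    by (intro always_eventually) (auto simp: baker_ericksen_quotient)
  ultimately have "((\<lambda>(d, e). (p_tan \<kappa> \<nu> \<gamma> \<beta> d e - p_rad \<kappa> \<nu> \<gamma> \<beta> d e) / (e - d))
      \<longlongrightarrow> 3 * \<kappa> * Q \<nu> \<gamma> \<beta> 1 * \<eta> powr (\<gamma> - 1)) ?F"
    by (rule Lim_transform_eventually)
  moreover have "3 * \<kappa> * Q \<nu> \<gamma> \<beta> 1 * \<eta> powr (\<gamma> - 1) \<ge> 0"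
    using assms True by simp
  ultimately show ?thesis
    unfolding baker_ericksen_at_def True by (simp only: simp_thms if_False) blast
qed

lemma baker_ericksen_atD:
  assumes "\<kappa> > 0" "\<delta> > 0" "\<eta> > 0" "\<delta> \<noteq> \<eta>"
    and "baker_ericksen_at (p_rad \<kappa> \<nu> \<gamma> \<beta>) (p_tan \<kappa> \<nu> \<gamma> \<beta>) \<delta> \<eta>"
  shows "Q \<nu> \<gamma> \<beta> (\<delta> / \<eta>) \<ge> 0"
proof -
  have "3 * \<kappa> * Q \<nu> \<gamma> \<beta> (\<delta> / \<eta>) * \<eta> powr (\<gamma> - 1) \<ge> 0"
    using assms(4,5) baker_ericksen_quotient[OF assms(2,3,4), of \<kappa> \<nu> \<gamma> \<beta>]
    by (simp add: baker_ericksen_at_def)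
  then show ?thesis
    using assms(1,3) by (simp add: zero_le_mult_iff)
qed

section \<open>The stored energy\<close>

text \<open>Since \<open>\<partial>\<^sub>\<eta> w\<close> is a positive multiple of the difference of the pressures, the Baker-Ericksen
  inequality makes \<open>w \<delta>\<close> monotone on either side of the diagonal, with its least value there.
  The mean value theorem keeps the evaluation points off the diagonal, where the inequality speaks
  of a quotient and not of a limit.\<close>

lemma stored_energy_ge_diagonal:
  assumes w: "is_stored_energy pr pt w" and pos: "\<delta> > 0" "\<eta> > 0"
    and BE: "\<And>e. min \<delta> \<eta> < e \<Longrightarrow> e < max \<delta> \<eta> \<Longrightarrow> baker_ericksen_at pr pt \<delta> e"
  shows "w \<delta> \<eta> \<ge> w \<delta> \<delta>"
proof -
  define D where "D e = (pt \<delta> e - pr \<delta> e) / (3 / 2 * \<delta> * e)" for e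
  have D: "(w \<delta> has_real_derivative D e) (at e)" if "e > 0" for e
  proof -
    have "(w \<delta> has_real_derivative deriv (w \<delta>) e) (at e)"
      using w pos(1) that unfolding is_stored_energy_def
      by (metis DERIV_imp_deriv real_differentiable_def)
    moreover have "deriv (w \<delta>) e = D e"
      using w pos(1) that unfolding is_stored_energy_def D_def by auto
    ultimately show ?thesis by simp
  qed
  have sgn: "(e - \<delta>) * D e \<ge> 0" if "min \<delta> \<eta> < e" "e < max \<delta> \<eta>" for e
  proof -
    have e: "e > 0" "e \<noteq> \<delta>"
      using that pos by (auto simp: min_def max_def split: if_splits)
    have "(e - \<delta>) * D e = (e - \<delta>)\<^sup>2 / (3 / 2 * \<delta> * e) * ((pt \<delta> e - pr \<delta> e) / (e - \<delta>))"
    proof -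
      have "d * (x / k) = d\<^sup>2 / k * (x / d)" if "d \<noteq> 0" for d x k :: real
        using that by (simp add: power2_eq_square)
      then show ?thesis
        unfolding D_def using e by (metis right_minus_eq)
    qed
    also have "\<dots> \<ge> 0"
    proof (rule mult_nonneg_nonneg)
      show "(pt \<delta> e - pr \<delta> e) / (e - \<delta>) \<ge> 0"
        using BE[OF that] e by (simp add: baker_ericksen_at_def)
    qed (use e pos in simp)
    finally show ?thesis .
  qed
  consider "\<delta> < \<eta>" | "\<delta> = \<eta>" | "\<eta> < \<delta>" by linarith
  then show ?thesis
  proof cases
    case 1
    then obtain z where z: "\<delta> < z" "z < \<eta>" "w \<delta> \<eta> - w \<delta> \<delta> = (\<eta> - \<delta>) * D z"
      using MVT2[of \<delta> \<eta> "w \<delta>" D] D pos by auto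
    then have "D z \<ge> 0"
      using sgn[of z] by (simp add: zero_le_mult_iff)
    then show ?thesis
      using z 1 by (smt (verit) mult_nonneg_nonneg)
  next
    case 3
    then obtain z where z: "\<eta> < z" "z < \<delta>" "w \<delta> \<delta> - w \<delta> \<eta> = (\<delta> - \<eta>) * D z"
      using MVT2[of \<eta> \<delta> "w \<delta>" D] D pos by auto
    then have "D z \<le> 0"
      using sgn[of z] by (simp add: zero_le_mult_iff)
    then show ?thesis
      using z 3 by (smt (verit) mult_nonneg_nonpos)
  qed simp
qed

text \<open>The derivative of \<open>S\<close> has the sign of \<open>(y powr \<beta> - 1) / \<beta>\<close>, which is that of \<open>y - 1\<close> for
  either sign of \<open>\<beta>\<close>.\<close>

lemma S_nonneg:
  assumes "-1 < \<nu>" "\<nu> \<le> 1 / 2" "\<beta> \<noteq> 0" "y > 0"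
  shows "S \<nu> \<beta> y \<ge> 0"
proof -
  define D where "D t = (1 - \<nu>) / (1 + \<nu>) * box_cox \<beta> t / t\<^sup>2" for t
  have D: "(S \<nu> \<beta> has_real_derivative D t) (at t)" if "t > 0" for t
    using S_has_derivative[OF that assms(3), of \<nu>] assms(3) by (simp add: D_def box_cox_def mult.assoc)
  have S1: "S \<nu> \<beta> 1 = 0"
    using assms(3) by (simp add: S_def divide_simps)
  have "S \<nu> \<beta> 1 \<le> S \<nu> \<beta> y"
  proof (cases "1 \<le> y")
    case True
    have "D t \<ge> 0" if "1 \<le> t" for t
      unfolding D_def using box_cox_mono[of 1 t \<beta>] that assms(1,2)
      by (intro divide_nonneg_nonneg mult_nonneg_nonneg) auto
    then show ?thesis
      using DERIV_nonneg_imp_nondecreasing[OF True, of "S \<nu> \<beta>"] D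
      by (meson less_le_trans zero_less_one)
  next
    case False
    have "D t \<le> 0" if "y \<le> t" "t \<le> 1" for t
      unfolding D_def using box_cox_mono[of t 1 \<beta>] that assms
      by (intro divide_nonpos_nonneg mult_nonneg_nonpos) auto
    then show ?thesis
      using DERIV_nonpos_imp_nonincreasing[of y 1 "S \<nu> \<beta>"] D False assms(4)
      by (meson less_le_trans linear)
  qed
  then show ?thesis
    by (simp add: S1)
qed

text \<open>At \<open>y = 1\<close> the part of the energy that depends on \<open>\<beta>\<close> vanishes, and
  \<open>1 / (\<gamma> - 1) - 1 / \<gamma> = 1 / (\<gamma> * (\<gamma> - 1))\<close> turns the rest into the function \<open>S\<close> with exponent \<open>\<gamma>\<close>.\<close>

lemma w_explicit_diagonal:
  assumes "-1 < \<nu>" "\<nu> \<le> 1 / 2" "\<gamma> > 0" "\<beta> \<noteq> 0" "\<delta> > 0"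
  shows "w_explicit \<kappa> \<nu> \<gamma> \<beta> \<delta> \<delta> = \<kappa> * (S \<nu> \<gamma> \<delta> / ((1 - \<nu>) / (1 + \<nu>)))"
proof -
  have S1: "S \<nu> \<beta> 1 = 0"
    using assms(4) by (simp add: S_def divide_simps)
  have a: "(1 - \<nu>) / (1 + \<nu>) \<noteq> 0"
    using assms by simp
  show ?thesis
  proof (cases "\<gamma> = 1")
    case True
    then show ?thesis
      using assms a by (simp add: w_explicit_def S1) (simp add: S_def)
  next
    case False
    then have "\<gamma> - 1 \<noteq> 0" by simp
    then have "P * (- (1 / \<gamma>) + 1 / (\<gamma> - 1)) = P / (\<gamma> * (\<gamma> - 1))" for P
      using assms(3) by (simp add: field_simps)
    moreover have "S \<nu> \<gamma> \<delta> / ((1 - \<nu>) / (1 + \<nu>))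
        = \<delta> powr (\<gamma> - 1) / (\<gamma> * (\<gamma> - 1)) + inverse \<delta> / \<gamma> - 1 / (\<gamma> - 1)"
      unfolding S_def using False a by (simp only: if_True nonzero_mult_div_cancel_left simp_thms)
    ultimately show ?thesis
      using False assms by (simp add: w_explicit_def S1)
  qed
qed

section \<open>The characterisation\<close>

theorem proposition3:
  fixes \<kappa> \<nu> \<gamma> \<beta> :: real
  assumes "\<kappa> > 0" and "- 1 < \<nu>" and "\<nu> \<le> 1 / 2" and "\<gamma> > 0" and "\<beta> \<noteq> 0"
    and "\<beta> \<le> 3 * ((1 - \<nu>) / (1 + \<nu>)) * \<gamma>"
  shows "weak_baker_ericksen (p_rad \<kappa> \<nu> \<gamma> \<beta>) (p_tan \<kappa> \<nu> \<gamma> \<beta>) \<and>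
    weak_nonneg_energy (stored_energy (p_rad \<kappa> \<nu> \<gamma> \<beta>) (p_tan \<kappa> \<nu> \<gamma> \<beta>)) \<and>
    (strong_baker_ericksen (p_rad \<kappa> \<nu> \<gamma> \<beta>) (p_tan \<kappa> \<nu> \<gamma> \<beta>) \<and>
     strong_nonneg_energy (stored_energy (p_rad \<kappa> \<nu> \<gamma> \<beta>) (p_tan \<kappa> \<nu> \<gamma> \<beta>)) \<longleftrightarrow>
       \<beta> \<ge> min \<gamma> (3 * ((1 - \<nu>) / (1 + \<nu>)) * \<gamma> - 2 * (1 - 2 * \<nu>) / (1 + \<nu>))) \<and>
    min \<gamma> (3 * ((1 - \<nu>) / (1 + \<nu>)) * \<gamma> - 2 * (1 - 2 * \<nu>) / (1 + \<nu>)) =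
      (if \<gamma> \<ge> 1 then \<gamma> else 3 * ((1 - \<nu>) / (1 + \<nu>)) * \<gamma> - 2 * (1 - 2 * \<nu>) / (1 + \<nu>))"
proof -
  define a where "a = (1 - \<nu>) / (1 + \<nu>)"
  define pr where "pr = p_rad \<kappa> \<nu> \<gamma> \<beta>"
  define pt where "pt = p_tan \<kappa> \<nu> \<gamma> \<beta>"
  define w where "w = w_explicit \<kappa> \<nu> \<gamma> \<beta>"
  have a: "3 * a \<ge> 1" and \<beta>: "\<beta> \<le> 3 * a * \<gamma>"
    using assms by (auto simp: a_def field_simps)
  have "2 * (1 - 2 * \<nu>) / (1 + \<nu>) = 3 * a - 1"
    using assms(2) by (simp add: a_def field_simps)
  then have m: "3 * ((1 - \<nu>) / (1 + \<nu>)) * \<gamma> - 2 * (1 - 2 * \<nu>) / (1 + \<nu>) = 3 * a * (\<gamma> - 1) + 1"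
    by (simp add: right_diff_distrib flip: a_def)
  have gap: "3 * a * (\<gamma> - 1) + 1 - \<gamma> = (3 * a - 1) * (\<gamma> - 1)"
    by (simp add: algebra_simps)
  have min: "min \<gamma> (3 * a * (\<gamma> - 1) + 1) = (if \<gamma> \<ge> 1 then \<gamma> else 3 * a * (\<gamma> - 1) + 1)"
  proof (cases "\<gamma> \<ge> 1")
    case True
    then have "(3 * a - 1) * (\<gamma> - 1) \<ge> 0" using a by simp
    then show ?thesis using True gap by simp
  next
    case False
    then have "(3 * a - 1) * (\<gamma> - 1) \<le> 0" using a by (simp add: mult_nonneg_nonpos)
    then show ?thesis using False gap by simp
  qed
  have BE_I: "baker_ericksen_at pr pt \<delta> \<eta>" if "Q \<nu> \<gamma> \<beta> (\<delta> / \<eta>) \<ge> 0" "\<delta> > 0" "\<eta> > 0" for \<delta> \<eta>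
    unfolding pr_def pt_def using that assms by (intro baker_ericksen_atI) auto
  have weak: "baker_ericksen_at pr pt \<delta> \<eta>" if "\<delta> > 0" "\<eta> \<ge> \<delta>" for \<delta> \<eta>
    using that assms by (intro BE_I Q_nonneg_le_1[OF a_def a _ _ \<beta>]) auto
  have strong_BE: "strong_baker_ericksen pr pt" if "\<beta> \<ge> min \<gamma> (3 * a * (\<gamma> - 1) + 1)"
    unfolding strong_baker_ericksen_def
  proof (intro allI impI)
    fix \<delta> \<eta> :: real assume "\<delta> > 0" "\<eta> > 0"
    then show "baker_ericksen_at pr pt \<delta> \<eta>"
      using weak Q_nonneg_ge_1[OF a_def a assms(5) that, of "\<delta> / \<eta>"]
      by (cases "\<delta> \<le> \<eta>") (auto intro: BE_I)
  qed
  have only_if: "\<beta> \<ge> min \<gamma> (3 * a * (\<gamma> - 1) + 1)" if "strong_baker_ericksen pr pt"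
  proof (rule ccontr)
    assume "\<not> ?thesis"
    then have "\<beta> < \<gamma>" "\<beta> < 3 * a * (\<gamma> - 1) + 1"
      by simp_all
    then obtain y where y: "y > 1" "Q \<nu> \<gamma> \<beta> y < 0"
      by (rule Q_negative_somewhere[OF a_def a assms(5)])
    then have "baker_ericksen_at pr pt y 1"
      using that by (simp add: strong_baker_ericksen_def)
    then have "Q \<nu> \<gamma> \<beta> (y / 1) \<ge> 0"
      unfolding pr_def pt_def by (intro baker_ericksen_atD) (use assms y in auto)
    then show False using y by simp
  qed
  have w: "is_stored_energy pr pt w"
    unfolding pr_def pt_def w_def using w_explicit_is_stored_energy assms by blast
  have nonneg: "stored_energy pr pt \<delta> \<eta> \<ge> 0"
    if "\<delta> > 0" "\<eta> > 0" "\<And>e. min \<delta> \<eta> < e \<Longrightarrow> e < max \<delta> \<eta> \<Longrightarrow> baker_ericksen_at pr pt \<delta> e" for \<delta> \<eta>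
  proof -
    have "0 \<le> w \<delta> \<delta>"
      unfolding w_def using w_explicit_diagonal[of \<nu> \<gamma> \<beta> \<delta> \<kappa>] S_nonneg[of \<nu> \<gamma> \<delta>] assms that(1)
      by simp
    also have "\<dots> \<le> w \<delta> \<eta>"
      using stored_energy_ge_diagonal[OF w that] .
    also have "\<dots> = stored_energy pr pt \<delta> \<eta>"
      using stored_energy_eq[OF w] that by simp
    finally show ?thesis .
  qed
  have "weak_baker_ericksen pr pt"
    using weak by (simp add: weak_baker_ericksen_def)
  moreover have "weak_nonneg_energy (stored_energy pr pt)"
    unfolding weak_nonneg_energy_def using weak by (auto intro!: nonneg)
  moreover have "strong_nonneg_energy (stored_energy pr pt)" if "strong_baker_ericksen pr pt"
    using that unfolding strong_nonneg_energy_def strong_baker_ericksen_def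
    by (auto intro!: nonneg)
  ultimately show ?thesis
    unfolding m min using strong_BE only_if unfolding min pr_def pt_def by blast
qed

end
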